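(* Let $$A = \begin{bmatrix} 0 &1 \\ 1 &1 \end{bmatrix}, \qquad B = \begin{bmatrix} -1 &0 \\0 &0 \end{bmatrix}, \qquad C = \begin{bmatrix} 1 &0 \\0 &0 \end{bmatrix},$$ and for $p \in \{1,2,\infty\}$ consider the problem $$\min_{X\in\mathbb{R}^{2\times 2},\ \operatorname{rank}(X) \le 1} \lVert A - BXC \rVert_{\sigma,p}.$$ For each $p\in\{1,2,\infty\}$ the minimum equals the unconstrained minimum $\min_{X \in \mathbb{R}^{2\times 2}} \lVert A - BXC \rVert_{\sigma,p}$. Any rank-one matrix $X_*\in\mathbb{R}^{2\times 2}$ whose $(1,1)$ entry is $1$ is a minimizer for $p=1$; any rank-one matrix whose $(1,1)$ entry is $0$ is a minimizer for $p=2$; and any rank-one matrix whose $(1,1)$ entry is $-1$ is a minimizer for $p=\infty$. The minimizers for $p=1,2,\infty$ are all distinct, i.e., no matrix is a minimizer for two different values of $p \in\{1,2,\infty\}$. Consequently the solution of $\min_{\operatorname{rank}(X)\le r}\lVert A-BXC\rVert_{\sigma,p}$ in general depends on the value of $p$.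
   Context: For $p\in[1,\infty]$, $\lVert X\rVert_{\sigma,p}$ is the Schatten $p$-norm, i.e., the vector $p$-norm of the vector of singular values of $X$ ($p=1$: nuclear norm, $p=2$: Frobenius norm, $p=\infty$: spectral norm). *)

theory Defs
  imports
    "HOL-Library.Extended_Nonnegative_Real"
    "HOL-Computational_Algebra.Fundamental_Theorem_Algebra"
    "Jordan_Normal_Form.Char_Poly"
    "Jordan_Normal_Form.DL_Rank"
begin

abbreviation mat_rank :: "real mat \<Rightarrow> nat" where
  "mat_rank X \<equiv> vec_space.rank (dim_row X) X"

text \<open>The singular values of an $m \times n$ matrix are the $\min(m,n)$ square roots of the
  eigenvalues, counted with multiplicity, of the smaller of the two Gram matrices. These are
  positive semidefinite, so all roots of the characteristic polynomial are real and nonnegative.\<close>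

definition singular_values :: "real mat \<Rightarrow> real multiset" where
  "singular_values X =
     image_mset sqrt
       (proots (char_poly (if dim_col X \<le> dim_row X then transpose_mat X * X
                           else X * transpose_mat X)))"

text \<open>The $p$-norm is invariant under permutation of the entries, so it is taken of the multiset of
  entries. Inserting \<open>0\<close> into the maximum matters only for the empty multiset.\<close>

definition p_norm :: "ennreal \<Rightarrow> real multiset \<Rightarrow> real" where
  "p_norm p S =
     (if p = \<infinity> then Max (insert 0 (abs ` set_mset S))
      else (\<Sum>s\<in>#S. \<bar>s\<bar> powr enn2real p) powr (1 / enn2real p))"

definition schatten_norm :: "ennreal \<Rightarrow> real mat \<Rightarrow> real" where
  "schatten_norm p X = p_norm p (singular_values X)"

definition objective :: "ennreal \<Rightarrow> real mat \<Rightarrow> real mat \<Rightarrow> real mat \<Rightarrow> real mat \<Rightarrow> real" where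
  "objective p A B C X = schatten_norm p (A - B * X * C)"

definition minimizer :: "ennreal \<Rightarrow> real mat \<Rightarrow> real mat \<Rightarrow> real mat \<Rightarrow> real mat \<Rightarrow> bool" where
  "minimizer p A B C =
     is_arg_min (objective p A B C) (\<lambda>X. X \<in> carrier_mat (dim_col B) (dim_row C))"

definition rank_minimizer ::
    "ennreal \<Rightarrow> nat \<Rightarrow> real mat \<Rightarrow> real mat \<Rightarrow> real mat \<Rightarrow> real mat \<Rightarrow> bool" where
  "rank_minimizer p r A B C =
     is_arg_min (objective p A B C)
       (\<lambda>X. X \<in> carrier_mat (dim_col B) (dim_row C) \<and> mat_rank X \<le> r)"

end

theory Submission
  imports Defs
begin

text \<open>
  For \<open>X\<close> with \<open>(1,1)\<close> entry \<open>x\<close>, the residual \<open>A - B X C\<close> is the matrix with rows \<open>(x, 1)\<close> and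
  \<open>(1, 1)\<close>; no other entry of \<open>X\<close> enters. The problem is therefore one-dimensional, and the rank
  constraint costs nothing, because every real number is the \<open>(1,1)\<close> entry of a matrix of rank at
  most one. In particular a minimizer of the unconstrained problem may be chosen of rank at most one.

  The singular values \<open>s \<ge> t \<ge> 0\<close> of a \<open>2 \<times> 2\<close> matrix are determined by \<open>s\<^sup>2 + t\<^sup>2\<close>, the sum of the
  squared entries, and \<open>s t\<close>, the modulus of the determinant (\<open>singular_values_2x2\<close>). Here these are
  \<open>x\<^sup>2 + 3\<close> and \<open>\<bar>x - 1\<bar>\<close>, so that
  \<^item> \<open>(s + t)\<^sup>2 = x\<^sup>2 + 3 + 2 \<bar>x - 1\<bar>\<close> is at least \<open>4\<close>, with equality exactly for \<open>x = 1\<close>;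
  \<^item> \<open>s\<^sup>2 + t\<^sup>2 = x\<^sup>2 + 3\<close> is at least \<open>3\<close>, with equality exactly for \<open>x = 0\<close>;
  \<^item> \<open>(s\<^sup>2 - 2) (2 - t\<^sup>2) = (x + 1)\<^sup>2\<close>, which forces \<open>s\<^sup>2 \<ge> 2\<close>, with equality exactly for \<open>x = -1\<close>.

  Thus for each of the three norms there is a value of \<open>x\<close> that characterizes the minimizers
  (\<open>objective_minimal_iff\<close>), and the three values \<open>1\<close>, \<open>0\<close>, \<open>-1\<close> are distinct. That each bound
  is attained at one point only is what makes the sets of minimizers disjoint.
\<close>

section \<open>Two-by-two matrices and their singular values\<close>

lemma carrier_rows_2x2 [simp]: "mat_of_rows_list 2 [[a, b], [c, d]] \<in> carrier_mat 2 2"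
  by (rule carrier_matI) (simp_all add: mat_of_rows_list_def)

lemma det_2x2:
  assumes M: "(M :: 'a :: comm_ring_1 mat) \<in> carrier_mat 2 2"
  shows "det M = M $$ (0,0) * M $$ (1,1) - M $$ (0,1) * M $$ (1,0)"
proof -
  have "det M = (\<Sum>i<2. M $$ (i,0) * cofactor M i 0)"
    by (rule laplace_expansion_column[OF M]) simp
  also have "\<dots> = M $$ (0,0) * cofactor M 0 0 + M $$ (1,0) * cofactor M 1 0"
    by (simp add: numeral_2_eq_2)
  also have "cofactor M 0 0 = M $$ (1,1)"
    unfolding cofactor_def using M
    by (subst det_single) (auto simp: mat_delete_def)
  also have "cofactor M 1 0 = - M $$ (0,1)"
    unfolding cofactor_def using M
    by (subst det_single) (auto simp: mat_delete_def)
  finally show ?thesis by (simp add: algebra_simps)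
qed

lemma char_poly_2x2:
  assumes M: "(M :: 'a :: comm_ring_1 mat) \<in> carrier_mat 2 2"
  shows "char_poly M = [: det M, - (M $$ (0,0) + M $$ (1,1)), 1 :]"
proof -
  have "char_poly M = det (char_poly_matrix M)" by (simp add: char_poly_def)
  also have "\<dots> = [: - (M $$ (0,0)), 1 :] * [: - (M $$ (1,1)), 1 :]
      - [: - (M $$ (0,1)) :] * [: - (M $$ (1,0)) :]"
    using M by (subst det_2x2) (auto simp: char_poly_matrix_def)
  also have "\<dots> = [: det M, - (M $$ (0,0) + M $$ (1,1)), 1 :]"
    by (simp add: det_2x2[OF M])
  finally show ?thesis .
qed

text \<open>The Gram matrix has trace \<open>q\<close> and determinant \<open>d\<^sup>2\<close>. Its eigenvalues are squares of numbers that
  are best found through their sum and difference, whose squares are \<open>q + 2 \<bar>d\<bar>\<close> and \<open>q - 2 \<bar>d\<bar>\<close>.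
  Both are nonnegative because \<open>q \<plusminus> 2 d\<close> is \<open>(a \<plusminus> e)\<^sup>2 + (b \<minusplus> c)\<^sup>2\<close> for the entries \<open>a, b, c, e\<close>.\<close>

lemma singular_values_2x2:
  fixes M :: "real mat"
  assumes M: "M \<in> carrier_mat 2 2"
  obtains s t where "singular_values M = {#s, t#}" "0 \<le> t" "t \<le> s"
    "s\<^sup>2 + t\<^sup>2 = (M $$ (0,0))\<^sup>2 + (M $$ (0,1))\<^sup>2 + (M $$ (1,0))\<^sup>2 + (M $$ (1,1))\<^sup>2"
    "s * t = \<bar>det M\<bar>"
proof -
  define a b c e where abce: "a = M $$ (0,0)" "b = M $$ (0,1)" "c = M $$ (1,0)" "e = M $$ (1,1)"
  define q where "q = a\<^sup>2 + b\<^sup>2 + c\<^sup>2 + e\<^sup>2"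
  define d where "d = det M"
  have d: "d = a * e - b * c"
    by (simp add: d_def det_2x2[OF M] abce)
  have "0 \<le> (a - e)\<^sup>2 + (b + c)\<^sup>2" "0 \<le> (a + e)\<^sup>2 + (b - c)\<^sup>2" by simp_all
  then have q: "2 * \<bar>d\<bar> \<le> q"
    unfolding q_def d by (auto simp: power2_eq_square algebra_simps abs_if)
  define u v where uv_def: "u = sqrt (q + 2 * \<bar>d\<bar>)" "v = sqrt (q - 2 * \<bar>d\<bar>)"
  have u2: "u\<^sup>2 = q + 2 * \<bar>d\<bar>" and v2: "v\<^sup>2 = q - 2 * \<bar>d\<bar>"
    using q by (simp_all add: uv_def)
  have uv: "0 \<le> v" "v \<le> u" using q by (simp_all add: uv_def)
  define s t where st_def: "s = (u + v) / 2" "t = (u - v) / 2"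
  have st: "0 \<le> t" "t \<le> s" using uv by (simp_all add: st_def)
  have "s\<^sup>2 + t\<^sup>2 = (u\<^sup>2 + v\<^sup>2) / 2" by (simp add: st_def power2_eq_square field_simps)
  then have sum: "s\<^sup>2 + t\<^sup>2 = q" by (simp add: u2 v2)
  have "s * t = (u\<^sup>2 - v\<^sup>2) / 4" by (simp add: st_def power2_eq_square field_simps)
  then have prod: "s * t = \<bar>d\<bar>" by (simp add: u2 v2)
  define G where "G = transpose_mat M * M"
  have G: "G \<in> carrier_mat 2 2" using M by (simp add: G_def)
  have G_diag: "G $$ (0,0) = a\<^sup>2 + c\<^sup>2" "G $$ (1,1) = b\<^sup>2 + e\<^sup>2"
    using M by (auto simp: G_def abce scalar_prod_def numeral_2_eq_2 power2_eq_square)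
  have G_det: "det G = s\<^sup>2 * t\<^sup>2"
  proof -
    have "det G = d\<^sup>2"
      using M by (simp add: G_def d_def det_mult[of _ 2] det_transpose power2_eq_square)
    also have "\<dots> = (s * t)\<^sup>2" by (simp add: prod)
    finally show ?thesis by (simp add: power_mult_distrib)
  qed
  have trace: "G $$ (0,0) + G $$ (1,1) = s\<^sup>2 + t\<^sup>2"
    by (simp only: sum G_diag q_def)
  have "char_poly G = [: - s\<^sup>2, 1 :] * [: - t\<^sup>2, 1 :]"
    by (simp only: char_poly_2x2[OF G] G_det trace) simp
  then have "proots (char_poly G) = proots [: - s\<^sup>2, 1 :] + proots [: - t\<^sup>2, 1 :]"
    by (simp only:) (rule proots_mult, simp_all)
  then have "proots (char_poly (transpose_mat M * M)) = {# s\<^sup>2, t\<^sup>2 #}"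
    by (simp add: G_def)
  then have "singular_values M = {#s, t#}"
    using M st by (simp add: singular_values_def)
  with st sum prod show thesis
    by (intro that) (simp_all add: q_def d_def abce)
qed

lemma mat_rank_corner_le_1: "mat_rank (mat_of_rows_list 2 [[x, 0], [0, 0]]) \<le> 1"
proof -
  define X where "X = mat_of_rows_list 2 [[x, 0], [0, 0]]"
  have X: "X \<in> carrier_mat 2 2" by (simp add: X_def)
  have "det X = 0" by (simp add: det_2x2[OF X]) (simp add: X_def mat_of_rows_list_def)
  with X have "vec_space.rank 2 X < 2" by (rule vec_space.det_zero_low_rank)
  moreover have "dim_row X = 2" using X by simp
  ultimately have "mat_rank X \<le> 1" by simp
  then show ?thesis unfolding X_def .
qed

section \<open>The three norms of a pair of singular values\<close>

lemma p_norm_pair: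
  assumes "0 \<le> t" "t \<le> s"
  shows "p_norm 1 {#s, t#} = s + t"
    and "p_norm 2 {#s, t#} = sqrt (s\<^sup>2 + t\<^sup>2)"
    and "p_norm \<infinity> {#s, t#} = s"
proof -
  have "0 \<le> s" using assms by simp
  show "p_norm 1 {#s, t#} = s + t" using assms \<open>0 \<le> s\<close> by (simp add: p_norm_def)
  have "x powr 2 = x\<^sup>2" if "0 \<le> x" for x :: real using that by simp
  then show "p_norm 2 {#s, t#} = sqrt (s\<^sup>2 + t\<^sup>2)"
    using assms \<open>0 \<le> s\<close> by (simp add: p_norm_def powr_half_sqrt)
  show "p_norm \<infinity> {#s, t#} = s" using assms \<open>0 \<le> s\<close> by (simp add: p_norm_def max_def)
qed

section \<open>Reduction to a single real variable\<close>

definition residual :: "real \<Rightarrow> real mat" where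
  "residual x = mat_of_rows_list 2 [[x, 1], [1, 1]]"

lemma residual_eq:
  assumes X: "X \<in> carrier_mat 2 2"
  shows "mat_of_rows_list 2 [[0, 1], [1, 1]]
      - mat_of_rows_list 2 [[-1, 0], [0, 0]] * X * mat_of_rows_list 2 [[1, 0], [0, 0]]
    = residual (X $$ (0,0))"
    (is "?A - ?B * X * ?C = _")
proof (rule eq_matI)
  fix i j assume "i < dim_row (residual (X $$ (0,0)))" "j < dim_col (residual (X $$ (0,0)))"
  then have "i = 0 \<or> i = 1" "j = 0 \<or> j = 1"
    by (auto simp: residual_def mat_of_rows_list_def)
  then show "(?A - ?B * X * ?C) $$ (i, j) = residual (X $$ (0,0)) $$ (i, j)"
    using X by (auto simp: residual_def mat_of_rows_list_def scalar_prod_def numeral_2_eq_2)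
qed (simp_all add: residual_def mat_of_rows_list_def)

lemma singular_values_residual:
  obtains s t where "singular_values (residual x) = {#s, t#}" "0 \<le> t" "t \<le> s"
    "s\<^sup>2 + t\<^sup>2 = x\<^sup>2 + 3" "s * t = \<bar>x - 1\<bar>"
proof -
  have R: "residual x \<in> carrier_mat 2 2" by (simp add: residual_def)
  have entries: "residual x $$ (0,0) = x" "residual x $$ (0,1) = 1" "residual x $$ (1,0) = 1"
    "residual x $$ (1,1) = 1"
    by (simp_all add: residual_def mat_of_rows_list_def)
  have "det (residual x) = x - 1" by (simp only: det_2x2[OF R] entries)
  moreover obtain s t where "singular_values (residual x) = {#s, t#}" "0 \<le> t" "t \<le> s"
    "s\<^sup>2 + t\<^sup>2 = x\<^sup>2 + 1\<^sup>2 + 1\<^sup>2 + 1\<^sup>2" "s * t = \<bar>det (residual x)\<bar>"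
    by (rule singular_values_2x2[OF R, unfolded entries])
  ultimately show thesis by (intro that) simp_all
qed

text \<open>Only the exponents \<open>1\<close>, \<open>2\<close> and \<open>\<infinity>\<close> matter in the following two definitions; their last branch
  stands for \<open>\<infinity>\<close>.\<close>

definition best_entry :: "ennreal \<Rightarrow> real" where
  "best_entry p = (if p = 1 then 1 else if p = 2 then 0 else -1)"

definition least_norm :: "ennreal \<Rightarrow> real" where
  "least_norm p = (if p = 1 then 2 else if p = 2 then sqrt 3 else sqrt 2)"

lemma best_entry_inj: "inj_on best_entry {1, 2, \<infinity>}"
  by (auto simp: inj_on_def best_entry_def)

lemma schatten_1_residual:
  "2 \<le> schatten_norm 1 (residual x)" "schatten_norm 1 (residual x) = 2 \<longleftrightarrow> x = 1"
proof -
  obtain s t where st: "singular_values (residual x) = {#s, t#}" "0 \<le> t" "t \<le> s"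
    "s\<^sup>2 + t\<^sup>2 = x\<^sup>2 + 3" "s * t = \<bar>x - 1\<bar>"
    by (rule singular_values_residual)
  have norm: "schatten_norm 1 (residual x) = s + t"
    using st by (simp add: schatten_norm_def p_norm_pair)
  have "(s + t)\<^sup>2 = x\<^sup>2 + 3 + 2 * \<bar>x - 1\<bar>"
    using st(4,5) by (simp add: power2_sum)
  \<comment> \<open>Expansion around \<open>x = 1\<close> exhibits the excess over \<open>4\<close> as a sum of nonnegative terms.\<close>
  also have "\<dots> = 2\<^sup>2 + ((x - 1)\<^sup>2 + 2 * (\<bar>x - 1\<bar> + (x - 1)))"
    by (simp add: power2_eq_square algebra_simps)
  finally have sq: "(s + t)\<^sup>2 = 2\<^sup>2 + ((x - 1)\<^sup>2 + 2 * (\<bar>x - 1\<bar> + (x - 1)))" .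
  have excess: "0 \<le> \<bar>x - 1\<bar> + (x - 1)" by simp
  then have "0 \<le> (x - 1)\<^sup>2 + 2 * (\<bar>x - 1\<bar> + (x - 1))"
    by (intro add_nonneg_nonneg[OF zero_le_power2 mult_nonneg_nonneg[OF zero_le_numeral]])
  then have "2\<^sup>2 \<le> (s + t)\<^sup>2" unfolding sq by (simp only: le_add_same_cancel1)
  then show "2 \<le> schatten_norm 1 (residual x)"
    unfolding norm by (rule power2_le_imp_le) (use st(2,3) in simp)
  have "s + t = 2 \<longleftrightarrow> (s + t)\<^sup>2 = 2\<^sup>2"
    by (rule power2_eq_iff_nonneg[symmetric]) (use st(2,3) in simp_all)
  also have "\<dots> \<longleftrightarrow> (x - 1)\<^sup>2 + 2 * (\<bar>x - 1\<bar> + (x - 1)) = 0"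
    unfolding sq by (rule add_cancel_left_right)
  also have "\<dots> \<longleftrightarrow> x = 1"
  proof
    assume "(x - 1)\<^sup>2 + 2 * (\<bar>x - 1\<bar> + (x - 1)) = 0"
    then have "(x - 1)\<^sup>2 = 0"
      by (rule add_nonneg_eq_0_iff[OF zero_le_power2 mult_nonneg_nonneg[OF zero_le_numeral excess],
            THEN iffD1, THEN conjunct1])
    then show "x = 1" by simp
  qed simp
  finally show "schatten_norm 1 (residual x) = 2 \<longleftrightarrow> x = 1" unfolding norm .
qed

lemma schatten_2_residual: "schatten_norm 2 (residual x) = sqrt (x\<^sup>2 + 3)"
proof -
  obtain s t where st: "singular_values (residual x) = {#s, t#}" "0 \<le> t" "t \<le> s"
    "s\<^sup>2 + t\<^sup>2 = x\<^sup>2 + 3" "s * t = \<bar>x - 1\<bar>"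
    by (rule singular_values_residual)
  then show ?thesis by (simp add: schatten_norm_def p_norm_pair)
qed

text \<open>The number \<open>-(x + 1)\<^sup>2\<close> is the value at \<open>2\<close> of the characteristic polynomial of the Gram matrix,
  so \<open>2\<close> lies between the squared singular values. The second row of the residual, of squared norm
  \<open>2\<close>, is what keeps the spectral norm from being smaller.\<close>

lemma schatten_inf_residual:
  "sqrt 2 \<le> schatten_norm \<infinity> (residual x)" "schatten_norm \<infinity> (residual x) = sqrt 2 \<longleftrightarrow> x = -1"
proof -
  obtain s t where st: "singular_values (residual x) = {#s, t#}" "0 \<le> t" "t \<le> s"
    "s\<^sup>2 + t\<^sup>2 = x\<^sup>2 + 3" "s * t = \<bar>x - 1\<bar>"
    by (rule singular_values_residual)
  have norm: "schatten_norm \<infinity> (residual x) = s"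
    by (simp only: schatten_norm_def st(1) p_norm_pair[OF st(2,3)])
  have "t\<^sup>2 \<le> s\<^sup>2" using st by (simp add: power_mono)
  have "s\<^sup>2 * t\<^sup>2 = (x - 1)\<^sup>2" using st(5) by (metis power2_abs power_mult_distrib)
  moreover have "(s\<^sup>2 - 2) * (2 - t\<^sup>2) = 2 * (s\<^sup>2 + t\<^sup>2) - s\<^sup>2 * t\<^sup>2 - 4"
    by (simp add: algebra_simps)
  ultimately have char: "(s\<^sup>2 - 2) * (2 - t\<^sup>2) = (x + 1)\<^sup>2"
    by (simp only: st(4)) (simp add: power2_eq_square algebra_simps)
  have s2: "2 \<le> s\<^sup>2"
  proof (rule ccontr)
    assume "\<not> 2 \<le> s\<^sup>2"
    with \<open>t\<^sup>2 \<le> s\<^sup>2\<close> have "(s\<^sup>2 - 2) * (2 - t\<^sup>2) < 0" by (intro mult_neg_pos) auto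
    with char show False by (simp add: not_less)
  qed
  then show "sqrt 2 \<le> schatten_norm \<infinity> (residual x)"
    unfolding norm using st by (intro real_le_lsqrt) auto
  have "s = sqrt 2 \<longleftrightarrow> s\<^sup>2 = 2"
    using st by (metis order_trans real_sqrt_abs abs_of_nonneg real_sqrt_pow2 zero_le_numeral)
  also have "\<dots> \<longleftrightarrow> x = -1"
  proof
    assume "s\<^sup>2 = 2"
    with char have "(x + 1)\<^sup>2 = 0" by simp
    then show "x = -1" by (simp add: add_eq_0_iff)
  next
    assume "x = -1"
    with st(4) have sum: "s\<^sup>2 + t\<^sup>2 = 4" by simp
    then have "2 - t\<^sup>2 = s\<^sup>2 - 2" by linarith
    with char \<open>x = -1\<close> have "(s\<^sup>2 - 2) * (s\<^sup>2 - 2) = 0" by simp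
    then show "s\<^sup>2 = 2" by simp
  qed
  finally show "schatten_norm \<infinity> (residual x) = sqrt 2 \<longleftrightarrow> x = -1" unfolding norm .
qed

lemma least_norm_residual:
  assumes "p \<in> {1, 2, \<infinity>}"
  shows "least_norm p \<le> schatten_norm p (residual x)"
    and "schatten_norm p (residual x) = least_norm p \<longleftrightarrow> x = best_entry p"
  using assms schatten_1_residual[of x] schatten_inf_residual[of x]
  by (auto simp: least_norm_def best_entry_def schatten_2_residual)

lemma is_arg_min_iff_attained:
  fixes f :: "'a \<Rightarrow> 'b :: linorder"
  assumes "\<And>x. P x \<Longrightarrow> m \<le> f x" and "P w" and "f w = m"
  shows "is_arg_min f P x \<longleftrightarrow> P x \<and> f x = m"
  using assms unfolding is_arg_min_def by (metis leD order.not_eq_order_implies_strict)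

text \<open>Both feasible sets contain the matrix \<open>W\<close> below, at which the bound on the norm is attained, so
  in either problem the minimizers are the feasible matrices attaining that same bound. This is why
  the rank constraint does not raise the minimum.\<close>

lemma objective_minimal_iff:
  fixes A B C :: "real mat"
  assumes A: "A = mat_of_rows_list 2 [[0, 1], [1, 1]]"
    and B: "B = mat_of_rows_list 2 [[-1, 0], [0, 0]]"
    and C: "C = mat_of_rows_list 2 [[1, 0], [0, 0]]"
    and p: "p \<in> {1, 2, \<infinity>}"
  shows "rank_minimizer p 1 A B C X \<longleftrightarrow>
      X \<in> carrier_mat 2 2 \<and> mat_rank X \<le> 1 \<and> X $$ (0,0) = best_entry p"
    and "minimizer p A B C X \<longleftrightarrow> X \<in> carrier_mat 2 2 \<and> X $$ (0,0) = best_entry p"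
proof -
  have dims: "dim_col B = 2" "dim_row C = 2" by (simp_all add: B C mat_of_rows_list_def)
  have obj: "objective p A B C Y = schatten_norm p (residual (Y $$ (0,0)))"
    if "Y \<in> carrier_mat 2 2" for Y
    unfolding objective_def A B C residual_eq[OF that] ..
  have lower: "least_norm p \<le> objective p A B C Y" if "Y \<in> carrier_mat 2 2" for Y
    using that p by (simp add: obj least_norm_residual(1))
  have attained: "objective p A B C Y = least_norm p \<longleftrightarrow> Y $$ (0,0) = best_entry p"
    if "Y \<in> carrier_mat 2 2" for Y
    using that p by (simp add: obj least_norm_residual(2))
  define W where "W = mat_of_rows_list 2 [[best_entry p, 0], [0, 0]]"
  have W: "W \<in> carrier_mat 2 2" "W $$ (0,0) = best_entry p" "mat_rank W \<le> 1"
    using mat_rank_corner_le_1[of "best_entry p"] unfolding W_def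
    by (simp, simp add: mat_of_rows_list_def, simp only:)
  have "rank_minimizer p 1 A B C X \<longleftrightarrow>
      (X \<in> carrier_mat 2 2 \<and> mat_rank X \<le> 1) \<and> objective p A B C X = least_norm p"
    unfolding rank_minimizer_def dims
    by (rule is_arg_min_iff_attained[where w = W]) (use W lower attained in auto)
  then show "rank_minimizer p 1 A B C X \<longleftrightarrow>
      X \<in> carrier_mat 2 2 \<and> mat_rank X \<le> 1 \<and> X $$ (0,0) = best_entry p"
    using attained by auto
  have "minimizer p A B C X \<longleftrightarrow> X \<in> carrier_mat 2 2 \<and> objective p A B C X = least_norm p"
    unfolding minimizer_def dims
    by (rule is_arg_min_iff_attained[where w = W]) (use W lower attained in auto)
  then show "minimizer p A B C X \<longleftrightarrow> X \<in> carrier_mat 2 2 \<and> X $$ (0,0) = best_entry p"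
    using attained by auto
qed

section \<open>The counterexample\<close>

theorem mainTheorem5:
  fixes A B C :: "real mat"
  assumes A: "A = mat_of_rows_list 2 [[0, 1], [1, 1]]"
    and B: "B = mat_of_rows_list 2 [[-1, 0], [0, 0]]"
    and C: "C = mat_of_rows_list 2 [[1, 0], [0, 0]]"
  shows
    "(\<forall>p \<in> {1, 2, \<infinity>}. \<exists>X Y. rank_minimizer p 1 A B C X \<and> minimizer p A B C Y \<and>
        objective p A B C X = objective p A B C Y) \<and>
     (\<forall>X \<in> carrier_mat 2 2. mat_rank X = 1 \<longrightarrow> X $$ (0, 0) = 1 \<longrightarrow> rank_minimizer 1 1 A B C X) \<and>
     (\<forall>X \<in> carrier_mat 2 2. mat_rank X = 1 \<longrightarrow> X $$ (0, 0) = 0 \<longrightarrow> rank_minimizer 2 1 A B C X) \<and>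
     (\<forall>X \<in> carrier_mat 2 2. mat_rank X = 1 \<longrightarrow> X $$ (0, 0) = -1 \<longrightarrow> rank_minimizer \<infinity> 1 A B C X) \<and>
     (\<forall>p \<in> {1, 2, \<infinity>}. \<forall>q \<in> {1, 2, \<infinity>}. p \<noteq> q \<longrightarrow>
        \<not> (\<exists>X. rank_minimizer p 1 A B C X \<and> rank_minimizer q 1 A B C X)) \<and>
     (\<exists>m n k l r. \<exists>A' \<in> carrier_mat m n. \<exists>B' \<in> carrier_mat m k. \<exists>C' \<in> carrier_mat l n.
        \<exists>p \<in> {1, 2, \<infinity>}. \<exists>q \<in> {1, 2, \<infinity>}.
          (\<exists>X. rank_minimizer p r A' B' C' X) \<and> (\<exists>X. rank_minimizer q r A' B' C' X) \<and>
          \<not> (\<exists>X. rank_minimizer p r A' B' C' X \<and> rank_minimizer q r A' B' C' X))"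
proof -
  note char = objective_minimal_iff[OF A B C]
  have witness: "\<exists>X. rank_minimizer p 1 A B C X \<and> minimizer p A B C X" if "p \<in> {1, 2, \<infinity>}" for p
  proof -
    define W where "W = mat_of_rows_list 2 [[best_entry p, 0], [0, 0]]"
    have "W \<in> carrier_mat 2 2" by (simp add: W_def)
    moreover have "W $$ (0,0) = best_entry p" by (simp add: W_def mat_of_rows_list_def)
    moreover have "mat_rank W \<le> 1" unfolding W_def by (rule mat_rank_corner_le_1)
    ultimately show ?thesis using char(1,2)[OF that] by blast
  qed
  have distinct: "\<not> (\<exists>X. rank_minimizer p 1 A B C X \<and> rank_minimizer q 1 A B C X)"
    if "p \<in> {1, 2, \<infinity>}" "q \<in> {1, 2, \<infinity>}" "p \<noteq> q" for p q
  proof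
    assume "\<exists>X. rank_minimizer p 1 A B C X \<and> rank_minimizer q 1 A B C X"
    then have "best_entry p = best_entry q" using char(1)[OF that(1)] char(1)[OF that(2)] by metis
    from inj_onD[OF best_entry_inj this that(1,2)] that(3) show False by contradiction
  qed
  have carriers: "A \<in> carrier_mat 2 2" "B \<in> carrier_mat 2 2" "C \<in> carrier_mat 2 2"
    by (simp_all add: A B C)
  have solvable: "\<exists>X. rank_minimizer 1 1 A B C X" "\<exists>X. rank_minimizer 2 1 A B C X"
    using witness[of 1] witness[of 2] by blast+
  have disjoint: "\<not> (\<exists>X. rank_minimizer 1 1 A B C X \<and> rank_minimizer 2 1 A B C X)"
    by (rule distinct) auto
  have dependence: "\<exists>m n k l r. \<exists>A' \<in> carrier_mat m n. \<exists>B' \<in> carrier_mat m k.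
      \<exists>C' \<in> carrier_mat l n. \<exists>p \<in> {1, 2, \<infinity>}. \<exists>q \<in> {1, 2, \<infinity>}.
        (\<exists>X. rank_minimizer p r A' B' C' X) \<and> (\<exists>X. rank_minimizer q r A' B' C' X) \<and>
        \<not> (\<exists>X. rank_minimizer p r A' B' C' X \<and> rank_minimizer q r A' B' C' X)"
    by (rule exI[of _ 2], rule exI[of _ 2], rule exI[of _ 2], rule exI[of _ 2], rule exI[of _ 1],
        rule bexI[OF _ carriers(1)], rule bexI[OF _ carriers(2)], rule bexI[OF _ carriers(3)],
        rule bexI[of _ 1], rule bexI[of _ 2], intro conjI solvable disjoint) simp_all
  have entries: "rank_minimizer p 1 A B C X"
    if "p \<in> {1, 2, \<infinity>}" "X \<in> carrier_mat 2 2" "mat_rank X = 1" "X $$ (0,0) = best_entry p" for p X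
    using that by (simp only: char(1)[OF that(1)] order_refl simp_thms)
  show ?thesis
  proof (intro conjI)
    show "\<forall>p \<in> {1, 2, \<infinity>}. \<exists>X Y. rank_minimizer p 1 A B C X \<and> minimizer p A B C Y \<and>
        objective p A B C X = objective p A B C Y"
      using witness by blast
    show "\<forall>X \<in> carrier_mat 2 2. mat_rank X = 1 \<longrightarrow> X $$ (0, 0) = 1 \<longrightarrow> rank_minimizer 1 1 A B C X"
      using entries[of 1] by (simp add: best_entry_def)
    show "\<forall>X \<in> carrier_mat 2 2. mat_rank X = 1 \<longrightarrow> X $$ (0, 0) = 0 \<longrightarrow> rank_minimizer 2 1 A B C X"
      using entries[of 2] by (simp add: best_entry_def)
    show "\<forall>X \<in> carrier_mat 2 2. mat_rank X = 1 \<longrightarrow> X $$ (0, 0) = -1 \<longrightarrow> rank_minimizer \<infinity> 1 A B C X"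
      using entries[of \<infinity>] by (simp add: best_entry_def)
  qed (use distinct dependence in blast)+
qed

end
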